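(* Let $m \geq 2$ and $n \geq 2$ be integers and let $\Sigma$ be an alphabet with at least four symbols. Consider the decision problem: given a coloring $c : [m] \times [n] \to \Sigma$, accessible only by querying the value $c(i,j)$ of individual cells, decide whether the grid graph $G_c$ contains a cycle. Then every deterministic algorithm that correctly decides this problem for all colorings must, in the worst case, query all $mn$ cells.
   Context: For a coloring $c : [m] \times [n] \to \Sigma$ of the cells of an $m \times n$ grid, the grid graph $G_c$ has vertex set $[m] \times [n]$ and an (undirected) edge between $(i,j)$ and $(i',j')$ if and only if $|i-i'| + |j-j'| = 1$ and $c(i,j) = c(i',j')$. A cycle means a cycle in this undirected simple graph. A deterministic algorithm adaptively chooses which cell to query next based on the answers received so far, and must eventually output whether $G_c$ has a cycle. *)

theory Defs
  imports Main "HOL-Library.FuncSet"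
begin

type_synonym cell = "nat \<times> nat"

definition cells :: "nat \<Rightarrow> nat \<Rightarrow> cell set" where
  "cells m n = {1..m} \<times> {1..n}"

definition colorings :: "nat \<Rightarrow> nat \<Rightarrow> 'a set \<Rightarrow> (cell \<Rightarrow> 'a) set" where
  "colorings m n \<Sigma> = cells m n \<rightarrow>\<^sub>E \<Sigma>"

definition cell_dist :: "cell \<Rightarrow> cell \<Rightarrow> int" where
  "cell_dist p q = \<bar>int (fst p) - int (fst q)\<bar> + \<bar>int (snd p) - int (snd q)\<bar>"

text \<open>An undirected simple graph is a pair of a vertex set and a set of two-element edges.\<close>

type_synonym 'v ugraph = "'v set \<times> 'v set set"

definition grid_graph :: "nat \<Rightarrow> nat \<Rightarrow> (cell \<Rightarrow> 'a) \<Rightarrow> cell ugraph" where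
  "grid_graph m n c =
     (cells m n,
      {{p, q} | p q. p \<in> cells m n \<and> q \<in> cells m n \<and> cell_dist p q = 1 \<and> c p = c q})"

text \<open>A cycle is given by its vertices in cyclic order, the first one not being repeated at the
  end; the bound 3 excludes traversing a single edge back and forth.\<close>

definition is_cycle :: "'v ugraph \<Rightarrow> 'v list \<Rightarrow> bool" where
  "is_cycle G vs \<longleftrightarrow>
     3 \<le> length vs \<and> distinct vs \<and> set vs \<subseteq> fst G \<and>
     (\<forall>i < length vs. {vs ! i, vs ! (Suc i mod length vs)} \<in> snd G)"

definition has_cycle :: "'v ugraph \<Rightarrow> bool" where
  "has_cycle G \<longleftrightarrow> (\<exists>vs. is_cycle G vs)"

text \<open>A deterministic algorithm maps the list of query-answer pairs seen so far, in chronological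
  order, to its next action. Termination is not built in; it is part of correctness below.\<close>

datatype action = Query cell | Output bool

type_synonym 'a algorithm = "(cell \<times> 'a) list \<Rightarrow> action"

definition grid_algorithm :: "nat \<Rightarrow> nat \<Rightarrow> 'a algorithm \<Rightarrow> bool" where
  "grid_algorithm m n A \<longleftrightarrow> (\<forall>h p. A h = Query p \<longrightarrow> p \<in> cells m n)"

text \<open>The history after at most \<open>k\<close> steps; it no longer changes once the algorithm outputs.\<close>

primrec history :: "'a algorithm \<Rightarrow> (cell \<Rightarrow> 'a) \<Rightarrow> nat \<Rightarrow> (cell \<times> 'a) list" where
  "history A c 0 = []"
| "history A c (Suc k) =
     (case A (history A c k) of
        Query p \<Rightarrow> history A c k @ [(p, c p)]
      | Output b \<Rightarrow> history A c k)"

definition outputs :: "'a algorithm \<Rightarrow> (cell \<Rightarrow> 'a) \<Rightarrow> bool \<Rightarrow> bool" where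
  "outputs A c b \<longleftrightarrow> (\<exists>k. A (history A c k) = Output b)"

definition queried_cells :: "'a algorithm \<Rightarrow> (cell \<Rightarrow> 'a) \<Rightarrow> cell set" where
  "queried_cells A c = {p. \<exists>k. A (history A c k) = Query p}"

definition decides_cycle :: "nat \<Rightarrow> nat \<Rightarrow> 'a set \<Rightarrow> 'a algorithm \<Rightarrow> bool" where
  "decides_cycle m n \<Sigma> A \<longleftrightarrow>
     (\<forall>c \<in> colorings m n \<Sigma>. outputs A c (has_cycle (grid_graph m n c)))"

end

theory Submission
  imports Defs
begin

text \<open>
  Each cell is allowed only two of four colours, so that a colouring is encoded by the set \<open>S\<close> of
  cells that take their first colour. For a predicate \<open>f\<close> on sets, let its alternating sum over
  \<open>A\<close> be \<open>\<Sum>T\<subseteq>A. (-1)\<^bsup>|T|\<^esup> [f T]\<close>. Fixing whether \<open>x\<close> belongs to \<open>T\<close> writes this sum as a difference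
  of two alternating sums over \<open>A - {x}\<close>, so an adversary can answer every query such that the
  alternating sum of ``acyclic'' over the remaining cells stays nonzero; and once the
  answer is determined while some cell is still unqueried, that sum vanishes.

  It remains to make the initial sum nonzero. Cut the grid into blocks with sides 2 or 3.
  The first colour of a cell is \<open>a\<close> or \<open>b\<close>, alternating like a checkerboard on the blocks, and its
  second colour is \<open>c\<close> or \<open>d\<close>, according to the parity of its row. Then cells with second colours
  are connected only within rows and form no cycle, while a cycle of first colours stays inside one
  block. So the alternating sum is the product of those of the blocks, which are -1 for
  2x2, 1 for 2x3 and -2 for 3x3.
\<close>

section \<open>Alternating sums over the subsets of a finite set\<close>

text \<open>If \<open>f\<close> is closed under subsets, this is minus the reduced Euler
  characteristic of the simplicial complex of sets satisfying \<open>f\<close>.\<close>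

definition alt_sum :: "('b set \<Rightarrow> bool) \<Rightarrow> 'b set \<Rightarrow> int" where
  "alt_sum f A = (\<Sum>T\<in>Pow A. (-1) ^ card T * of_bool (f T))"

lemma alt_sum_cong:
  assumes "\<And>T. T \<subseteq> A \<Longrightarrow> f T = g T"
  shows "alt_sum f A = alt_sum g A"
  unfolding alt_sum_def using assms by (intro sum.cong) auto

lemma alt_sum_empty [simp]: "alt_sum f {} = of_bool (f {})"
  by (simp add: alt_sum_def)

lemma alt_sum_insert:
  assumes "finite A" "x \<notin> A"
  shows "alt_sum f (insert x A) = alt_sum f A - alt_sum (\<lambda>T. f (insert x T)) A"
proof -
  have disj: "Pow A \<inter> insert x ` Pow A = {}" using assms by auto
  have inj: "inj_on (insert x) (Pow A)"
    using assms(2) by (intro inj_onI) (metis PowD insert_ident subsetD)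
  have "alt_sum f (insert x A) = alt_sum f A +
      (\<Sum>T\<in>insert x ` Pow A. (-1) ^ card T * of_bool (f T))"
    unfolding alt_sum_def Pow_insert using assms disj by (subst sum.union_disjoint) auto
  also have "(\<Sum>T\<in>insert x ` Pow A. (-1) ^ card T * of_bool (f T)) =
      (\<Sum>T\<in>Pow A. (-1) ^ card (insert x T) * of_bool (f (insert x T)))"
    using inj by (simp add: sum.reindex)
  also have "\<dots> = (\<Sum>T\<in>Pow A. - ((-1) ^ card T * of_bool (f (insert x T))) :: int)"
  proof (rule sum.cong[OF refl])
    fix T assume "T \<in> Pow A"
    then have "finite T" "x \<notin> T" using assms finite_subset by auto
    then show "(-1) ^ card (insert x T) * of_bool (f (insert x T)) =
        - ((-1) ^ card T * of_bool (f (insert x T)) :: int)" by simp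
  qed
  also have "\<dots> = - alt_sum (\<lambda>T. f (insert x T)) A"
    by (simp add: alt_sum_def sum_negf)
  finally show ?thesis by simp
qed

lemma alt_sum_const:
  assumes "finite A" "A \<noteq> {}"
  shows "alt_sum (\<lambda>_. b) A = 0"
proof -
  obtain x where "x \<in> A" using assms by auto
  then show ?thesis
    using alt_sum_insert[of "A - {x}" x "\<lambda>_. b"] assms by (simp add: insert_absorb)
qed

text \<open>The sign of \<open>T\<close> is the product of the signs of \<open>T \<inter> A\<close>
  and \<open>T \<inter> B\<close>. The induction keeps \<open>f\<close> arbitrary because splitting
  off \<open>x\<close> replaces \<open>f\<close> by
  \<open>\<lambda>T. f (insert x T)\<close>.\<close>

lemma alt_sum_Un_disjoint:
  assumes "finite A" "finite B" "A \<inter> B = {}"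
  shows "alt_sum (\<lambda>T. f (T \<inter> A) \<and> g (T \<inter> B)) (A \<union> B) = alt_sum f A * alt_sum g B"
  using assms
proof (induction A arbitrary: f rule: finite_induct)
  case empty
  have "alt_sum (\<lambda>T. f (T \<inter> {}) \<and> g (T \<inter> B)) B = alt_sum (\<lambda>T. f {} \<and> g T) B"
    by (rule alt_sum_cong) (simp add: Int_absorb2)
  then show ?case by (cases "f {}") (simp_all add: alt_sum_def)
next
  case (insert x A)
  have x: "x \<notin> A \<union> B" using insert by auto
  have "alt_sum (\<lambda>T. f (T \<inter> insert x A) \<and> g (T \<inter> B)) (insert x (A \<union> B)) =
      alt_sum (\<lambda>T. f (T \<inter> insert x A) \<and> g (T \<inter> B)) (A \<union> B) -
      alt_sum (\<lambda>T. f (insert x T \<inter> insert x A) \<and> g (insert x T \<inter> B)) (A \<union> B)"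
    using insert.hyps insert.prems x by (intro alt_sum_insert) auto
  also have "alt_sum (\<lambda>T. f (T \<inter> insert x A) \<and> g (T \<inter> B)) (A \<union> B) =
      alt_sum (\<lambda>T. f (T \<inter> A) \<and> g (T \<inter> B)) (A \<union> B)"
  proof (rule alt_sum_cong)
    fix T assume "T \<subseteq> A \<union> B"
    then have "T \<inter> insert x A = T \<inter> A" using x by auto
    then show "(f (T \<inter> insert x A) \<and> g (T \<inter> B)) = (f (T \<inter> A) \<and> g (T \<inter> B))" by simp
  qed
  also have "alt_sum (\<lambda>T. f (insert x T \<inter> insert x A) \<and> g (insert x T \<inter> B)) (A \<union> B) =
      alt_sum (\<lambda>T. f (insert x (T \<inter> A)) \<and> g (T \<inter> B)) (A \<union> B)"
  proof (rule alt_sum_cong)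
    fix T
    have "insert x T \<inter> insert x A = insert x (T \<inter> A)" "insert x T \<inter> B = T \<inter> B"
      using x by auto
    then show "(f (insert x T \<inter> insert x A) \<and> g (insert x T \<inter> B)) =
        (f (insert x (T \<inter> A)) \<and> g (T \<inter> B))" by simp
  qed
  also have "alt_sum (\<lambda>T. f (T \<inter> A) \<and> g (T \<inter> B)) (A \<union> B) = alt_sum f A * alt_sum g B"
    using insert.IH[of f] insert.prems by simp
  also have "alt_sum (\<lambda>T. f (insert x (T \<inter> A)) \<and> g (T \<inter> B)) (A \<union> B) =
      alt_sum (\<lambda>T. f (insert x T)) A * alt_sum g B"
    using insert.IH[of "\<lambda>T. f (insert x T)"] insert.prems by simp
  finally show ?case
    using insert.hyps by (simp add: alt_sum_insert algebra_simps)
qed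

lemma alt_sum_UN_disjoint:
  assumes "finite I" "\<And>i. i \<in> I \<Longrightarrow> finite (B i)"
    and "\<And>i j. i \<in> I \<Longrightarrow> j \<in> I \<Longrightarrow> i \<noteq> j \<Longrightarrow> B i \<inter> B j = {}"
  shows "alt_sum (\<lambda>T. \<forall>i\<in>I. g i (T \<inter> B i)) (\<Union>i\<in>I. B i) = (\<Prod>i\<in>I. alt_sum (g i) (B i))"
  using assms
proof (induction I rule: finite_induct)
  case empty
  then show ?case by simp
next
  case (insert k I)
  let ?U = "\<Union>i\<in>I. B i"
  have disj: "B k \<inter> ?U = {}" using insert.prems(2) insert.hyps by fastforce
  \<comment> \<open>The redex applied to \<open>T \<inter> ?U\<close> gives the remaining conjuncts
    the shape \<open>g (T \<inter> B)\<close> of \<open>alt_sum_Un_disjoint\<close>.\<close>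
  have "alt_sum (\<lambda>T. \<forall>i\<in>insert k I. g i (T \<inter> B i)) (B k \<union> ?U) =
      alt_sum (\<lambda>T. g k (T \<inter> B k) \<and> (\<lambda>T. \<forall>i\<in>I. g i (T \<inter> B i)) (T \<inter> ?U)) (B k \<union> ?U)"
  proof (rule alt_sum_cong)
    fix T
    have "T \<inter> ?U \<inter> B i = T \<inter> B i" if "i \<in> I" for i using that by auto
    then show "(\<forall>i\<in>insert k I. g i (T \<inter> B i)) =
        (g k (T \<inter> B k) \<and> (\<lambda>T. \<forall>i\<in>I. g i (T \<inter> B i)) (T \<inter> ?U))" by simp
  qed
  also have "\<dots> = alt_sum (g k) (B k) * alt_sum (\<lambda>T. \<forall>i\<in>I. g i (T \<inter> B i)) ?U"
    using insert.hyps insert.prems(1) disj by (intro alt_sum_Un_disjoint) auto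
  also have "alt_sum (\<lambda>T. \<forall>i\<in>I. g i (T \<inter> B i)) ?U = (\<Prod>i\<in>I. alt_sum (g i) (B i))"
    using insert.prems by (intro insert.IH) auto
  finally show ?case using insert.hyps by simp
qed

lemma alt_sum_image:
  assumes "finite A" "inj_on \<phi> A"
  shows "alt_sum f (\<phi> ` A) = alt_sum (\<lambda>T. f (\<phi> ` T)) A"
  using assms
proof (induction A arbitrary: f rule: finite_induct)
  case (insert x A)
  then have "\<phi> x \<notin> \<phi> ` A" "inj_on \<phi> A" by auto
  then show ?case using insert.hyps insert.IH by (simp add: alt_sum_insert)
qed simp

text \<open>An executable form of the recursion in \<open>alt_sum_insert\<close>: \<open>ys\<close>
  accumulates the elements already put into \<open>T\<close>.\<close>

primrec alt_sum_list :: "('b list \<Rightarrow> bool) \<Rightarrow> 'b list \<Rightarrow> 'b list \<Rightarrow> int" where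
  "alt_sum_list f [] ys = of_bool (f ys)"
| "alt_sum_list f (x # xs) ys = alt_sum_list f xs ys - alt_sum_list f xs (x # ys)"

lemma alt_sum_eq_alt_sum_list:
  assumes "distinct xs"
  shows "alt_sum (\<lambda>T. f (T \<union> set ys)) (set xs) = alt_sum_list (\<lambda>ys. f (set ys)) xs ys"
  using assms
proof (induction xs arbitrary: ys)
  case (Cons x xs)
  then show ?case using Cons.IH[of "x # ys"] Cons.IH[of ys] by (simp add: alt_sum_insert)
qed simp

section \<open>Query histories and the adversary\<close>

text \<open>Each query is determined by the earlier answers, so agreement along the run on
  \<open>c\<close> suffices. This lets the adversary change its colouring on unqueried
  cells.\<close>

lemma history_cong:
  assumes "\<And>p. p \<in> fst ` set (history A c k) \<Longrightarrow> c p = c' p"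
  shows "history A c' k = history A c k"
  using assms
proof (induction k)
  case (Suc k)
  have "history A c' k = history A c k"
    using Suc.prems by (intro Suc.IH) (auto split: action.splits)
  then show ?case using Suc.prems by (auto split: action.splits)
qed simp

lemma history_stable:
  assumes "A (history A c k) = Output b" "k \<le> l"
  shows "history A c l = history A c k"
  using assms(2)
  by (induction l rule: dec_induct) (use assms(1) in auto)

lemma fst_history_queried: "fst ` set (history A c k) \<subseteq> queried_cells A c"
proof (induction k)
  case (Suc k)
  then show ?case by (auto simp: queried_cells_def split: action.splits)
qed simp

text \<open>Only \<open>S \<inter> Q\<close> is committed; \<open>T\<close> ranges over the possible
  completions on the unqueried cells. An output or a repeated query leaves \<open>Q\<close> and the
  sum unchanged, and a new query splits the sum in two.\<close>

lemma adversary_invariant: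
  fixes col :: "cell set \<Rightarrow> cell \<Rightarrow> 'a"
  assumes "finite X" "\<forall>h p. A h = Query p \<longrightarrow> p \<in> X"
    and agree: "\<forall>S S' p. (p \<in> S \<longleftrightarrow> p \<in> S') \<longrightarrow> col S p = col S' p"
    and "alt_sum f X \<noteq> 0"
  shows "\<exists>S\<subseteq>X. let Q = fst ` set (history A (col S) k) in
           alt_sum (\<lambda>T. f (T \<union> (S \<inter> Q))) (X - Q) \<noteq> 0"
proof (induction k)
  case 0
  then show ?case using assms(4) by auto
next
  case (Suc k)
  then obtain S where S: "S \<subseteq> X"
    "alt_sum (\<lambda>T. f (T \<union> (S \<inter> fst ` set (history A (col S) k))))
       (X - fst ` set (history A (col S) k)) \<noteq> 0"
    by (auto simp: Let_def)
  define Q where "Q = fst ` set (history A (col S) k)"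
  note S = S[folded Q_def]
  show ?case
  proof (cases "A (history A (col S) k)")
    case (Output b)
    then show ?thesis using S by (intro exI[of _ S]) (simp add: Q_def)
  next
    case (Query p)
    show ?thesis
    proof (cases "p \<in> Q")
      case True
      then show ?thesis
        using S Query by (intro exI[of _ S]) (simp add: Q_def insert_absorb)
    next
      case False
      have p: "p \<in> X" using assms(2) Query by blast
      \<comment> \<open>\<open>Y\<close> records all answers up to and including the one at
        \<open>p\<close>. It agrees with \<open>S\<close> on \<open>Q\<close>, so the algorithm
        reaches the same query \<open>p\<close> on \<open>col Y\<close>.\<close>
      have step: ?thesis if "Y \<subseteq> X" "Y \<inter> Q = S \<inter> Q" "Y \<subseteq> insert p Q"
        "alt_sum (\<lambda>T. f (T \<union> Y)) (X - insert p Q) \<noteq> 0" for Y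
      proof -
        have "history A (col Y) k = history A (col S) k"
          using that(2) by (intro history_cong agree[rule_format]) (auto simp: Q_def)
        then have "fst ` set (history A (col Y) (Suc k)) = insert p Q"
          using Query by (simp add: Q_def)
        moreover have "Y \<inter> insert p Q = Y" using that(3) by auto
        ultimately show ?thesis using that(1,4) by (intro exI[of _ Y]) (simp add: Let_def)
      qed
      have X: "X - Q = insert p (X - insert p Q)" using p False by auto
      \<comment> \<open>The two terms belong to the answers "not in \<open>S\<close>" and "in
        \<open>S\<close>" at \<open>p\<close>. Their difference is nonzero, so one of the answers
        keeps the sum nonzero.\<close>
      have "alt_sum (\<lambda>T. f (T \<union> (S \<inter> Q))) (X - Q) =
          alt_sum (\<lambda>T. f (T \<union> (S \<inter> Q))) (X - insert p Q) -
          alt_sum (\<lambda>T. f (T \<union> insert p (S \<inter> Q))) (X - insert p Q)"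
        unfolding X using assms(1) by (subst alt_sum_insert) auto
      then have "alt_sum (\<lambda>T. f (T \<union> (S \<inter> Q))) (X - insert p Q) \<noteq> 0 \<or>
          alt_sum (\<lambda>T. f (T \<union> insert p (S \<inter> Q))) (X - insert p Q) \<noteq> 0"
        using S(2) by auto
      then show ?thesis
        using step[of "S \<inter> Q"] step[of "insert p (S \<inter> Q)"] S(1) p False by auto
    qed
  qed
qed

lemma alt_sum_nonzero_imp_evasive:
  fixes col :: "cell set \<Rightarrow> cell \<Rightarrow> 'a"
  assumes "finite X" "\<forall>h p. A h = Query p \<longrightarrow> p \<in> X"
    and agree: "\<forall>S S' p. (p \<in> S \<longleftrightarrow> p \<in> S') \<longrightarrow> col S p = col S' p"
    and outs: "\<And>S. S \<subseteq> X \<Longrightarrow> outputs A (col S) (\<not> f S)"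
    and "alt_sum f X \<noteq> 0"
  shows "\<exists>S\<subseteq>X. queried_cells A (col S) = X"
proof -
  obtain t where t: "\<And>S. S \<subseteq> X \<Longrightarrow> A (history A (col S) (t S)) = Output (\<not> f S)"
    using outs unfolding outputs_def by metis
  \<comment> \<open>One time bound for all colourings: as \<open>X\<close> has finitely many
    subsets, every run has stopped after \<open>K\<close> steps.\<close>
  define K where "K = Max (t ` Pow X)"
  have K: "A (history A (col S) K) = Output (\<not> f S)" if "S \<subseteq> X" for S
  proof -
    have "t S \<le> K" unfolding K_def using that assms(1) by (intro Max_ge) auto
    then show ?thesis using history_stable[of A "col S" "t S" "\<not> f S" K] t[OF that] by simp
  qed
  have inv: "\<exists>S\<subseteq>X. let Q = fst ` set (history A (col S) K) in
      alt_sum (\<lambda>T. f (T \<union> (S \<inter> Q))) (X - Q) \<noteq> 0"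
    by (rule adversary_invariant[OF assms(1,2) agree assms(5)])
  obtain S where S: "S \<subseteq> X"
    "alt_sum (\<lambda>T. f (T \<union> (S \<inter> fst ` set (history A (col S) K))))
       (X - fst ` set (history A (col S) K)) \<noteq> 0"
    using inv by (auto simp: Let_def)
  define Q where "Q = fst ` set (history A (col S) K)"
  note S = S[folded Q_def]
  \<comment> \<open>All completions of the answers on \<open>Q\<close> produce the same run and
    hence the same output, so \<open>f\<close> is constant on them and its alternating sum vanishes
    unless \<open>X - Q\<close> is empty.\<close>
  have "f (T \<union> (S \<inter> Q)) = f S" if "T \<subseteq> X - Q" for T
  proof -
    have "history A (col (T \<union> (S \<inter> Q))) K = history A (col S) K"
      using that by (intro history_cong agree[rule_format]) (auto simp: Q_def)
    moreover have "T \<union> (S \<inter> Q) \<subseteq> X" using that S(1) by auto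
    ultimately show ?thesis using K[of "T \<union> (S \<inter> Q)"] K[OF S(1)] by simp
  qed
  then have "alt_sum (\<lambda>T. f (T \<union> (S \<inter> Q))) (X - Q) = alt_sum (\<lambda>_. f S) (X - Q)"
    by (rule alt_sum_cong)
  then have "X \<subseteq> Q" using S(2) alt_sum_const[of "X - Q" "f S"] assms(1) by auto
  moreover have "queried_cells A (col S) \<subseteq> X" using assms(2) by (auto simp: queried_cells_def)
  ultimately have "queried_cells A (col S) = X"
    using fst_history_queried[of A "col S" K] by (auto simp: Q_def)
  then show ?thesis using S(1) by blast
qed

section \<open>Circuits inside a single block\<close>

text \<open>The second disjunct is the ring around the centre of a 3x3 block, the only cycle in a block
  whose vertex set contains no full 2x2 square.\<close>

definition has_circuit :: "cell set \<Rightarrow> bool" where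
  "has_circuit T \<longleftrightarrow>
     (\<exists>u\<in>{0,1}. \<exists>v\<in>{0,1}. {(u, v), (Suc u, v), (Suc u, Suc v), (u, Suc v)} \<subseteq> T) \<or>
     {(0,0), (0,1), (0,2), (1,2), (2,2), (2,1), (2,0), (1,0)} \<subseteq> T"

lemma has_circuit_mono: "has_circuit T \<Longrightarrow> T \<subseteq> T' \<Longrightarrow> has_circuit T'"
  unfolding has_circuit_def by blast

text \<open>Once unfolded, \<open>has_circuit\<close> is a finite check, so the four sums, over at
  most 512 subsets each, are simply evaluated.\<close>

lemma alt_sum_has_circuit_nonzero:
  assumes "h \<in> {2, 3}" "w \<in> {2, 3}"
  shows "alt_sum (\<lambda>T. \<not> has_circuit T) ({..<h} \<times> {..<w}) \<noteq> 0"
proof -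
  have "alt_sum (\<lambda>T. \<not> has_circuit T) (set (List.product [0..<h] [0..<w])) =
      alt_sum_list (\<lambda>ys. \<not> has_circuit (set ys)) (List.product [0..<h] [0..<w]) []"
    using alt_sum_eq_alt_sum_list[of "List.product [0..<h] [0..<w]" "\<lambda>T. \<not> has_circuit T" "[]"]
    by (simp add: distinct_product)
  moreover have "alt_sum_list (\<lambda>ys. \<not> has_circuit (set ys)) (List.product [0..<2] [0..<2]) [] \<noteq> 0"
    unfolding has_circuit_def by code_simp
  moreover have "alt_sum_list (\<lambda>ys. \<not> has_circuit (set ys)) (List.product [0..<2] [0..<3]) [] \<noteq> 0"
    unfolding has_circuit_def by code_simp
  moreover have "alt_sum_list (\<lambda>ys. \<not> has_circuit (set ys)) (List.product [0..<3] [0..<2]) [] \<noteq> 0"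
    unfolding has_circuit_def by code_simp
  moreover have "alt_sum_list (\<lambda>ys. \<not> has_circuit (set ys)) (List.product [0..<3] [0..<3]) [] \<noteq> 0"
    unfolding has_circuit_def by code_simp
  ultimately show ?thesis using assms by (auto simp: atLeast0LessThan)
qed

text \<open>Minimum degree 2 is all that is used of the vertex set of a cycle; unlike being a cycle, it
  passes to the part inside one block.\<close>

definition core_set :: "cell set \<Rightarrow> bool" where
  "core_set C \<longleftrightarrow> (\<forall>p\<in>C. \<exists>q\<in>C. \<exists>r\<in>C. q \<noteq> r \<and> cell_dist p q = 1 \<and> cell_dist p r = 1)"

text \<open>A corner in \<open>T\<close> forces both of its side cells. If the centre is in
  \<open>T\<close>, so is some side cell; that one needs a corner besides the centre, and the
  corner's two sides complete a 2x2 square. If the centre is not in \<open>T\<close>, every side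
  cell forces both adjacent corners, and this propagates around the whole ring.\<close>

lemma core_set_imp_has_circuit:
  assumes "T \<subseteq> {..<3} \<times> {..<3}" "T \<noteq> {}" "core_set T"
  shows "has_circuit T"
proof -
  have U: "{..<3::nat} = {0,1,2}" by auto
  \<comment> \<open>\<open>N\<close> lists the neighbours of \<open>p\<close> within the 3x3 square,
    so at least two of them lie in \<open>T\<close>.\<close>
  have two: "\<exists>q\<in>T \<inter> N. \<exists>r\<in>T \<inter> N. q \<noteq> r"
    if "p \<in> T" "\<forall>q\<in>{0,1,2} \<times> {0,1,2}. cell_dist p q = 1 \<longrightarrow> q \<in> N" for p N
    using assms(1,3) that unfolding core_set_def U by (meson IntI subsetD)
  have 1: "(0,1) \<in> T \<and> (1,0) \<in> T"
    if "(0,0) \<in> T"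
    using two[OF that, of "{(0,1), (1,0)}"] by (auto simp: cell_dist_def)
  have 2: "(0,1) \<in> T \<and> (1,2) \<in> T"
    if "(0,2) \<in> T"
    using two[OF that, of "{(0,1), (1,2)}"] by (auto simp: cell_dist_def)
  have 3: "(1,0) \<in> T \<and> (2,1) \<in> T"
    if "(2,0) \<in> T"
    using two[OF that, of "{(1,0), (2,1)}"] by (auto simp: cell_dist_def)
  have 4: "(1,2) \<in> T \<and> (2,1) \<in> T"
    if "(2,2) \<in> T"
    using two[OF that, of "{(1,2), (2,1)}"] by (auto simp: cell_dist_def)
  have 5: "(0,0) \<in> T \<and> (0,2) \<in> T \<or>
      (0,0) \<in> T \<and> (1,1) \<in> T \<or>
      (0,2) \<in> T \<and> (1,1) \<in> T"
    if "(0,1) \<in> T"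
    using two[OF that, of "{(0,0), (0,2), (1,1)}"] by (auto simp: cell_dist_def)
  have 6: "(0,0) \<in> T \<and> (1,1) \<in> T \<or>
      (0,0) \<in> T \<and> (2,0) \<in> T \<or>
      (1,1) \<in> T \<and> (2,0) \<in> T"
    if "(1,0) \<in> T"
    using two[OF that, of "{(0,0), (1,1), (2,0)}"] by (auto simp: cell_dist_def)
  have 7: "(0,2) \<in> T \<and> (1,1) \<in> T \<or>
      (0,2) \<in> T \<and> (2,2) \<in> T \<or>
      (1,1) \<in> T \<and> (2,2) \<in> T"
    if "(1,2) \<in> T"
    using two[OF that, of "{(0,2), (1,1), (2,2)}"] by (auto simp: cell_dist_def)
  have 8: "(1,1) \<in> T \<and> (2,0) \<in> T \<or>
      (1,1) \<in> T \<and> (2,2) \<in> T \<or>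
      (2,0) \<in> T \<and> (2,2) \<in> T"
    if "(2,1) \<in> T"
    using two[OF that, of "{(1,1), (2,0), (2,2)}"] by (auto simp: cell_dist_def)
  have 9: "(0,1) \<in> T \<or> (1,0) \<in> T \<or> (1,2) \<in> T \<or> (2,1) \<in> T"
    if "(1,1) \<in> T"
    using two[OF that, of "{(0,1), (1,0), (1,2), (2,1)}"] by (auto simp: cell_dist_def)
  obtain p where "p \<in> T" using assms(2) by auto
  with assms(1) have "(0,0) \<in> T \<or> (0,1) \<in> T \<or> (0,2) \<in> T \<or> (1,0) \<in> T \<or> (1,1) \<in> T \<or> (1,2) \<in> T
      \<or> (2,0) \<in> T \<or> (2,1) \<in> T \<or> (2,2) \<in> T" unfolding U by auto
  \<comment> \<open>Writing \<open>2\<close> as \<open>Suc (Suc 0)\<close> makes the cells in the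
    facts and in \<open>has_circuit\<close> the same atoms; what remains is propositional.\<close>
  then show ?thesis using 1 2 3 4 5 6 7 8 9
    unfolding has_circuit_def by (simp add: numeral_2_eq_2) argo
qed

section \<open>Edges and cycles of the grid graph\<close>

lemma grid_graph_edge_iff:
  "{p, q} \<in> snd (grid_graph m n c) \<longleftrightarrow>
     p \<in> cells m n \<and> q \<in> cells m n \<and> cell_dist p q = 1 \<and> c p = c q"
proof
  assume "{p, q} \<in> snd (grid_graph m n c)"
  then show "p \<in> cells m n \<and> q \<in> cells m n \<and> cell_dist p q = 1 \<and> c p = c q"
    by (auto simp: grid_graph_def doubleton_eq_iff cell_dist_def)
next
  assume "p \<in> cells m n \<and> q \<in> cells m n \<and> cell_dist p q = 1 \<and> c p = c q"
  then show "{p, q} \<in> snd (grid_graph m n c)"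
    unfolding grid_graph_def snd_conv by blast
qed

text \<open>The two neighbours are the predecessor and the successor in the cyclic order, which
  differ because the length is at least 3.\<close>

lemma is_cycle_neighbours:
  assumes "is_cycle G vs" "p \<in> set vs"
  shows "\<exists>q\<in>set vs. \<exists>r\<in>set vs. q \<noteq> r \<and> {p, q} \<in> snd G \<and> {p, r} \<in> snd G"
proof -
  let ?L = "length vs"
  have L: "3 \<le> ?L" "distinct vs"
    and e: "\<And>i. i < ?L \<Longrightarrow> {vs ! i, vs ! (Suc i mod ?L)} \<in> snd G"
    using assms(1) by (auto simp: is_cycle_def)
  obtain i where i: "i < ?L" "p = vs ! i" using assms(2) by (metis in_set_conv_nth)
  \<comment> \<open>The cyclic predecessor of \<open>i\<close>, wrapping around at 0; the edge
    condition at \<open>j\<close> then yields an edge ending in \<open>p\<close>.\<close>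
  define j where "j = (if i = 0 then ?L - 1 else i - 1)"
  have j: "j < ?L" "Suc j mod ?L = i" using i L by (auto simp: j_def)
  define k where "k = Suc i mod ?L"
  have k: "k < ?L" unfolding k_def using L(1) by (metis mod_less_divisor not_numeral_le_zero neq0_conv)
  have "k = (if Suc i = ?L then 0 else Suc i)" using i by (simp add: k_def)
  then have "j \<noteq> k" using i L by (auto simp: j_def split: if_splits)
  then have "vs ! j \<noteq> vs ! k" using L j k by (simp add: nth_eq_iff_index_eq)
  moreover have "{p, vs ! k} \<in> snd G" using e[OF i(1)] i by (simp add: k_def)
  moreover have "{p, vs ! j} \<in> snd G" using e[OF j(1)] i j by (simp add: insert_commute)
  ultimately show ?thesis using j k by (metis nth_mem)
qed


section \<open>Cutting the grid into blocks\<close>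

text \<open>Lines are counted from 1 and cut into pairs; for odd \<open>m\<close> the last group has three lines.\<close>

definition group_index :: "nat \<Rightarrow> nat \<Rightarrow> nat" where
  "group_index m i = min ((i - 1) div 2) (m div 2 - 1)"

definition group_size :: "nat \<Rightarrow> nat \<Rightarrow> nat" where
  "group_size m R = (if Suc R = m div 2 then 2 + m mod 2 else 2)"

lemma group_size_cases: "group_size m R \<in> {2, 3}"
  by (auto simp: group_size_def)

text \<open>Together with \<open>group_exhaust\<close>, this makes \<open>2 * R + 1 + u\<close> a
  bijective numbering of the lines. The offset \<open>u = 2\<close> occurs only in the last group of
  an odd \<open>m\<close>, where the \<open>min\<close> in \<open>group_index\<close> returns
  \<open>R\<close>.\<close>

lemma group_member:
  assumes "R < m div 2" "u < group_size m R"
  shows "group_index m (2 * R + 1 + u) = R" "2 * R + 1 + u \<le> m"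
proof -
  have "u < 2 \<or> u = 2 \<and> Suc R = m div 2 \<and> odd m"
    using assms(2) by (auto simp: group_size_def split: if_splits)
  then show "group_index m (2 * R + 1 + u) = R" "2 * R + 1 + u \<le> m"
    using assms(1) by (auto simp: group_index_def elim!: oddE)
qed

lemma group_exhaust:
  assumes "2 \<le> m" "1 \<le> i" "i \<le> m"
  obtains u where "group_index m i < m div 2" "u < group_size m (group_index m i)" "i = 2 * group_index m i + 1 + u"
proof
  have m: "m = 2 * (m div 2) + m mod 2" "m mod 2 < 2" and
    i: "i - 1 = 2 * ((i - 1) div 2) + (i - 1) mod 2" "(i - 1) mod 2 < 2" by auto
  show "group_index m i < m div 2" using assms m by (simp add: group_index_def)
  have "2 * group_index m i + 1 \<le> i" using assms i by (simp add: group_index_def)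
  then show "i = 2 * group_index m i + 1 + (i - (2 * group_index m i + 1))" by simp
  show "i - (2 * group_index m i + 1) < group_size m (group_index m i)"
  proof (cases "(i - 1) div 2 \<le> m div 2 - 1")
    case True
    then have "group_index m i = (i - 1) div 2" by (simp add: group_index_def)
    moreover have "2 \<le> group_size m (group_index m i)" by (simp add: group_size_def)
    ultimately show ?thesis using i by linarith
  next
    \<comment> \<open>Here \<open>m\<close> is odd and \<open>i = m\<close> is the extra third line
      of the last group.\<close>
    case False
    then have "group_index m i = m div 2 - 1" by (simp add: group_index_def)
    moreover have "m div 2 \<noteq> 0" using assms(1) by simp
    ultimately have "group_size m (group_index m i) = 2 + m mod 2" "2 * group_index m i + 2 = 2 * (m div 2)"
      by (auto simp: group_size_def)
    then show ?thesis using m assms by linarith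
  qed
qed

text \<open>Hence moving to an adjacent line flips the parity of the group index whenever it leaves
  the group.\<close>

lemma group_Suc: "group_index m (Suc i) = group_index m i \<or> group_index m (Suc i) = Suc (group_index m i)"
proof (cases i)
  case (Suc k)
  have "Suc k div 2 = k div 2 \<or> Suc k div 2 = Suc (k div 2)" by presburger
  then show ?thesis using Suc by (auto simp: group_index_def min_def)
qed (simp add: group_index_def)

text \<open>Block indices and positions inside a block count from 0, cells from 1. In these local
  coordinates every block is a window at the origin, where \<open>has_circuit\<close> is
  stated.\<close>

definition place :: "cell \<Rightarrow> cell \<Rightarrow> cell" where
  "place i p = (2 * fst i + 1 + fst p, 2 * snd i + 1 + snd p)"

definition window :: "nat \<Rightarrow> nat \<Rightarrow> cell \<Rightarrow> cell set" where
  "window m n i = {..<group_size m (fst i)} \<times> {..<group_size n (snd i)}"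

definition block_of :: "nat \<Rightarrow> nat \<Rightarrow> cell \<Rightarrow> cell" where
  "block_of m n p = (group_index m (fst p), group_index n (snd p))"

lemma inj_place: "inj (place i)"
  by (auto simp: inj_def place_def prod_eq_iff)

lemma cell_dist_place [simp]: "cell_dist (place i p) (place i q) = cell_dist p q"
  by (simp add: cell_dist_def place_def)

lemma place_in_cells:
  assumes "i \<in> {..<m div 2} \<times> {..<n div 2}" "p \<in> window m n i"
  shows "place i p \<in> cells m n" "block_of m n (place i p) = i"
  using assms group_member[of "fst i" m "fst p"] group_member[of "snd i" n "snd p"]
  by (auto simp: window_def cells_def place_def block_of_def prod_eq_iff)

lemma cell_in_block:
  assumes "2 \<le> m" "2 \<le> n" "p \<in> cells m n"
  shows "block_of m n p \<in> {..<m div 2} \<times> {..<n div 2}"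
    and "p \<in> place (block_of m n p) ` window m n (block_of m n p)"
proof -
  have b: "1 \<le> fst p" "fst p \<le> m" "1 \<le> snd p" "snd p \<le> n" using assms(3) by (auto simp: cells_def)
  obtain u where "group_index m (fst p) < m div 2" "u < group_size m (group_index m (fst p))"
      "fst p = 2 * group_index m (fst p) + 1 + u"
    using group_exhaust[OF assms(1) b(1,2)] .
  moreover obtain v where "group_index n (snd p) < n div 2" "v < group_size n (group_index n (snd p))"
      "snd p = 2 * group_index n (snd p) + 1 + v"
    using group_exhaust[OF assms(2) b(3,4)] .
  ultimately show "block_of m n p \<in> {..<m div 2} \<times> {..<n div 2}"
    and "p \<in> place (block_of m n p) ` window m n (block_of m n p)"
    by (auto simp: block_of_def window_def place_def prod_eq_iff intro!: image_eqI[of _ _ "(u, v)"])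
qed

section \<open>The colouring encoded by a set, and its cycles\<close>

text \<open>\<open>undefined\<close> outside the grid makes it an element of the extensional
  function space \<open>colorings\<close>. The colour of \<open>p\<close> depends on
  \<open>S\<close> only through \<open>p \<in> S\<close>, as the adversary requires.\<close>

definition two_coloring :: "nat \<Rightarrow> nat \<Rightarrow> 'a \<Rightarrow> 'a \<Rightarrow> 'a \<Rightarrow> 'a \<Rightarrow> cell set \<Rightarrow> cell \<Rightarrow> 'a" where
  "two_coloring m n a b c d S p =
     (if p \<notin> cells m n then undefined
      else if p \<in> S then (if even (group_index m (fst p) + group_index n (snd p)) then a else b)
      else (if even (fst p) then c else d))"

lemma cell_dist_1_cases:
  assumes "cell_dist p q = 1"
  obtains "fst p = fst q" "snd q = Suc (snd p)" | "fst p = fst q" "snd p = Suc (snd q)"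
    | "snd p = snd q" "fst q = Suc (fst p)" | "snd p = snd q" "fst p = Suc (fst q)"
proof -
  have "fst p = fst q \<and> snd q = Suc (snd p) \<or> fst p = fst q \<and> snd p = Suc (snd q) \<or>
      snd p = snd q \<and> fst q = Suc (fst p) \<or> snd p = snd q \<and> fst p = Suc (fst q)"
    using assms unfolding cell_dist_def by linarith
  then show ?thesis using that by blast
qed

text \<open>The first and second colours are disjoint pairs. Between first colours, crossing a block
  border changes exactly one group index by 1, which flips the checkerboard; between second colours,
  a change of row flips the row parity.\<close>

lemma two_coloring_adjacent:
  assumes "distinct [a, b, c, d]" "p \<in> cells m n" "q \<in> cells m n" "cell_dist p q = 1"
    and "two_coloring m n a b c d S p = two_coloring m n a b c d S q"
  shows "p \<in> S \<and> q \<in> S \<and> block_of m n p = block_of m n q \<or> p \<notin> S \<and> q \<notin> S \<and> fst p = fst q"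
proof (cases "p \<in> S")
  case True
  then have q: "q \<in> S" and
    e: "even (group_index m (fst p) + group_index n (snd p)) = even (group_index m (fst q) + group_index n (snd q))"
    using assms(1-3,5) by (auto simp: two_coloring_def split: if_splits)
  have "block_of m n p = block_of m n q"
    using assms(4)
  proof (cases rule: cell_dist_1_cases)
    case 1
    then show ?thesis using e group_Suc[of n "snd p"] by (auto simp: block_of_def)
  next
    case 2
    then show ?thesis using e group_Suc[of n "snd q"] by (auto simp: block_of_def)
  next
    case 3
    then show ?thesis using e group_Suc[of m "fst p"] by (auto simp: block_of_def)
  next
    case 4
    then show ?thesis using e group_Suc[of m "fst q"] by (auto simp: block_of_def)
  qed
  then show ?thesis using True q by simp
next
  case False
  then have q: "q \<notin> S" and e: "even (fst p) = even (fst q)"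
    using assms(1-3,5) by (auto simp: two_coloring_def split: if_splits)
  have "fst p = fst q"
    using assms(4) by (cases rule: cell_dist_1_cases) (use e in auto)
  then show ?thesis using False q by simp
qed

lemma circuit_imp_cycle:
  assumes "i \<in> {..<m div 2} \<times> {..<n div 2}" "T \<subseteq> window m n i" "has_circuit T" "place i ` T \<subseteq> S"
  shows "has_cycle (grid_graph m n (two_coloring m n a b c d S))"
proof -
  let ?col = "two_coloring m n a b c d S"
  have col: "?col (place i p) = (if even (fst i + snd i) then a else b)" if "p \<in> T" for p
  proof -
    have "p \<in> window m n i" "place i p \<in> S" using that assms(2,4) by auto
    then show ?thesis
      using place_in_cells[OF assms(1), of p] by (simp add: two_coloring_def block_of_def prod_eq_iff)
  qed
  have in_cells: "place i p \<in> cells m n" if "p \<in> T" for p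
    using place_in_cells(1)[OF assms(1)] that assms(2) by blast
  have edge: "{place i p, place i q} \<in> snd (grid_graph m n ?col)"
    if "p \<in> T" "q \<in> T" "cell_dist p q = 1" for p q
    using that col in_cells by (simp add: grid_graph_edge_iff)
  \<comment> \<open>The index condition is bounded by a set so that it unrolls for concrete lists;
    \<open>has_circuit\<close> names its cells in cyclic order, ready for use as
    \<open>vs\<close>.\<close>
  have cyc: ?thesis if "3 \<le> length vs" "distinct vs" "set vs \<subseteq> T"
    "\<forall>k\<in>{..<length vs}. cell_dist (vs ! k) (vs ! (Suc k mod length vs)) = 1" for vs
  proof -
    have "is_cycle (grid_graph m n ?col) (map (place i) vs)"
      unfolding is_cycle_def
    proof (intro conjI allI impI)
      show "distinct (map (place i) vs)"
        using that(2) inj_on_subset[OF inj_place] by (simp add: distinct_map)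
      show "set (map (place i) vs) \<subseteq> fst (grid_graph m n ?col)"
        using that(3) in_cells by (auto simp: grid_graph_def)
      fix k assume "k < length (map (place i) vs)"
      then have k: "k < length vs" by simp
      have "Suc k mod length vs < length vs"
        using that(1) by (intro mod_less_divisor) linarith
      then have "{place i (vs ! k), place i (vs ! (Suc k mod length vs))} \<in> snd (grid_graph m n ?col)"
        using k that(3,4) by (intro edge) (auto dest: nth_mem)
      then show "{map (place i) vs ! k, map (place i) vs ! (Suc k mod length (map (place i) vs))}
          \<in> snd (grid_graph m n ?col)"
        using k \<open>Suc k mod length vs < length vs\<close> by simp
    qed (use that(1) in simp)
    then show ?thesis by (auto simp: has_cycle_def)
  qed
  from assms(3) consider u v where "{(u, v), (Suc u, v), (Suc u, Suc v), (u, Suc v)} \<subseteq> T"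
    | "{(0,0), (0,1), (0,2), (1,2), (2,2), (2,1), (2,0), (1,0)} \<subseteq> T"
    unfolding has_circuit_def by blast
  then show ?thesis
  proof cases
    case 1
    then show ?thesis
      by (intro cyc[of "[(u, v), (Suc u, v), (Suc u, Suc v), (u, Suc v)]"])
        (auto simp: cell_dist_def lessThan_Suc)
  next
    case 2
    then show ?thesis
      by (intro cyc[of "[(0,0), (0,1), (0,2), (1,2), (2,2), (2,1), (2,0), (1,0)]"])
        (auto simp: cell_dist_def lessThan_Suc)
  qed
qed

text \<open>The leftmost cell of \<open>C\<close> can only have its right neighbour in
  \<open>C\<close>.\<close>

lemma core_set_not_in_row:
  assumes "core_set C" "finite C" "p \<in> C"
    and "\<And>q. q \<in> C \<Longrightarrow> fst q = r"
  shows False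
proof -
  define k where "k = Min (snd ` C)"
  have "k \<in> snd ` C" unfolding k_def using assms(2,3) by (intro Min_in) auto
  then obtain x where x: "x \<in> C" "snd x = k" by auto
  have ge: "k \<le> snd q" if "q \<in> C" for q unfolding k_def using that assms(2) by auto
  have "q = (r, Suc k)" if "q \<in> C" "cell_dist x q = 1" for q
    using that(2) by (cases rule: cell_dist_1_cases)
      (use x ge[OF that(1)] assms(4)[OF that(1)] assms(4)[OF x(1)] in \<open>auto simp: prod_eq_iff\<close>)
  then show False using assms(1) x(1) unfolding core_set_def by metis
qed

text \<open>Take one vertex \<open>p\<close> of the cycle. By \<open>two_coloring_adjacent\<close>,
  cycle neighbours stay in its row if \<open>p \<notin> S\<close> and in its block if
  \<open>p \<in> S\<close>, so the part of the cycle lying there has minimum degree 2.\<close>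

lemma cycle_imp_circuit:
  assumes mn: "2 \<le> m" "2 \<le> n" and dist: "distinct [a, b, c, d]"
    and "has_cycle (grid_graph m n (two_coloring m n a b c d S))"
  obtains i where "i \<in> {..<m div 2} \<times> {..<n div 2}" "has_circuit {p \<in> window m n i. place i p \<in> S}"
proof -
  let ?col = "two_coloring m n a b c d S"
  obtain vs where vs: "is_cycle (grid_graph m n ?col) vs" using assms(4) by (auto simp: has_cycle_def)
  have C: "set vs \<subseteq> cells m n" using vs by (auto simp: is_cycle_def grid_graph_def)
  obtain p where p: "p \<in> set vs" using vs by (cases vs) (auto simp: is_cycle_def)
  have nb: "\<exists>q\<in>set vs. \<exists>r\<in>set vs. q \<noteq> r \<and> cell_dist x q = 1 \<and> cell_dist x r = 1 \<and>
      ?col x = ?col q \<and> ?col x = ?col r" if "x \<in> set vs" for x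
    using is_cycle_neighbours[OF vs that] unfolding grid_graph_edge_iff by blast
  note adj = two_coloring_adjacent[OF dist]
  show ?thesis
  proof (cases "p \<in> S")
    case False
    let ?C = "{q \<in> set vs. q \<notin> S \<and> fst q = fst p}"
    have "core_set ?C"
      unfolding core_set_def
    proof
      fix x assume x: "x \<in> ?C"
      then obtain q r where qr: "q \<in> set vs" "r \<in> set vs" "q \<noteq> r" "cell_dist x q = 1"
        "cell_dist x r = 1" "?col x = ?col q" "?col x = ?col r" using nb[of x] by blast
      then have "x \<in> cells m n" "q \<in> cells m n" "r \<in> cells m n" using x C by auto
      then have "q \<notin> S \<and> fst x = fst q" "r \<notin> S \<and> fst x = fst r"
        using adj[OF _ _ qr(4,6)] adj[OF _ _ qr(5,7)] x by blast+
      then have "q \<in> ?C" "r \<in> ?C" using qr(1,2) x by simp_all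
      with qr show "\<exists>q\<in>?C. \<exists>r\<in>?C. q \<noteq> r \<and> cell_dist x q = 1 \<and> cell_dist x r = 1" by blast
    qed
    then have False
      by (rule core_set_not_in_row[where p = p and r = "fst p"]) (use p False in simp_all)
    then show ?thesis ..
  next
    case True
    define i where "i = block_of m n p"
    let ?T = "{t \<in> window m n i. place i t \<in> set vs \<and> place i t \<in> S}"
    have lift: "\<exists>t\<in>?T. x = place i t" if "x \<in> set vs" "x \<in> S" "block_of m n x = i" for x
    proof -
      have "x \<in> cells m n" using that(1) C by blast
      from cell_in_block(2)[OF mn this] have "x \<in> place i ` window m n i" unfolding that(3) .
      then show ?thesis using that(1,2) by blast
    qed
    have i: "i \<in> {..<m div 2} \<times> {..<n div 2}"
      using cell_in_block(1)[OF mn, of p] p C unfolding i_def by blast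
    have "core_set ?T"
      unfolding core_set_def
    proof
      fix t assume t: "t \<in> ?T"
      let ?x = "place i t"
      obtain q r where qr: "q \<in> set vs" "r \<in> set vs" "q \<noteq> r" "cell_dist ?x q = 1"
        "cell_dist ?x r = 1" "?col ?x = ?col q" "?col ?x = ?col r" using nb[of ?x] t by blast
      have x: "block_of m n ?x = i" using place_in_cells(2)[OF i] t by blast
      have "?x \<in> cells m n" "q \<in> cells m n" "r \<in> cells m n" using t qr(1,2) C by auto
      then have "q \<in> S \<and> block_of m n ?x = block_of m n q"
          "r \<in> S \<and> block_of m n ?x = block_of m n r"
        using adj[OF _ _ qr(4,6)] adj[OF _ _ qr(5,7)] t by blast+
      then have "q \<in> S" "r \<in> S" "block_of m n q = i" "block_of m n r = i" using x by simp_all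
      then obtain q' r' where q': "q' \<in> ?T" "q = place i q'" and r': "r' \<in> ?T" "r = place i r'"
        using lift[OF qr(1)] lift[OF qr(2)] by blast
      have "q' \<noteq> r' \<and> cell_dist t q' = 1 \<and> cell_dist t r' = 1"
        using qr(3-5) unfolding q'(2) r'(2) by auto
      then show "\<exists>q\<in>?T. \<exists>r\<in>?T. q \<noteq> r \<and> cell_dist t q = 1 \<and> cell_dist t r = 1"
        using q'(1) r'(1) by blast
    qed
    moreover have "?T \<subseteq> {..<3} \<times> {..<3}"
      using group_size_cases[of m "fst i"] group_size_cases[of n "snd i"]
      by (auto simp: window_def)
    moreover have "?T \<noteq> {}" using lift[OF p True i_def[symmetric]] by blast
    ultimately have "has_circuit ?T" by (intro core_set_imp_has_circuit) assumption+
    \<comment> \<open>Dropping membership in the cycle leaves a condition on \<open>S\<close>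
      alone.\<close>
    then have "has_circuit {t \<in> window m n i. place i t \<in> S}"
      by (rule has_circuit_mono) auto
    then show ?thesis using that i by blast
  qed
qed

section \<open>Factorization over the blocks and conclusion\<close>

lemma alt_sum_acyclic_nonzero:
  assumes mn: "2 \<le> m" "2 \<le> n" and dist: "distinct [a, b, c, d]"
  shows "alt_sum (\<lambda>S. \<not> has_cycle (grid_graph m n (two_coloring m n a b c d S))) (cells m n) \<noteq> 0"
proof -
  let ?I = "{..<m div 2} \<times> {..<n div 2}"
  define B where "B i = place i ` window m n i" for i
  \<comment> \<open>The preimage reads a set of grid cells in local coordinates; by injectivity of
    \<open>place i\<close> it undoes the image.\<close>
  define g where "g i T \<longleftrightarrow> \<not> has_circuit (place i -` T)" for i T
  have cells: "cells m n = (\<Union>i\<in>?I. B i)"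
  proof
    show "cells m n \<subseteq> (\<Union>i\<in>?I. B i)"
    proof
      fix p assume "p \<in> cells m n"
      then show "p \<in> (\<Union>i\<in>?I. B i)"
        unfolding B_def by (intro UN_I[of "block_of m n p"] cell_in_block[OF mn])
    qed
    show "(\<Union>i\<in>?I. B i) \<subseteq> cells m n"
      unfolding B_def by (intro UN_least image_subsetI place_in_cells(1))
  qed
  have vim: "place i -` (S \<inter> B i) = {p \<in> window m n i. place i p \<in> S}" for i S
    unfolding B_def vimage_Int inj_vimage_image_eq[OF inj_place] by blast
  \<comment> \<open>Acyclicity is a conjunction of conditions on the separate sets
    \<open>S \<inter> B i\<close>, the form in which the alternating sum factors.\<close>
  have "(\<not> has_cycle (grid_graph m n (two_coloring m n a b c d S))) = (\<forall>i\<in>?I. g i (S \<inter> B i))" for S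
  proof -
    have "has_cycle (grid_graph m n (two_coloring m n a b c d S)) \<longleftrightarrow>
        (\<exists>i\<in>?I. has_circuit {p \<in> window m n i. place i p \<in> S})"
    proof
      assume "has_cycle (grid_graph m n (two_coloring m n a b c d S))"
      then show "\<exists>i\<in>?I. has_circuit {p \<in> window m n i. place i p \<in> S}"
        by (rule cycle_imp_circuit[OF mn dist]) blast
    next
      assume "\<exists>i\<in>?I. has_circuit {p \<in> window m n i. place i p \<in> S}"
      then obtain i where "i \<in> ?I" "has_circuit {p \<in> window m n i. place i p \<in> S}" by blast
      then show "has_cycle (grid_graph m n (two_coloring m n a b c d S))"
        by (intro circuit_imp_cycle[of i m n "{p \<in> window m n i. place i p \<in> S}"]) auto
    qed
    then show ?thesis unfolding g_def vim by blast
  qed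
  then have "alt_sum (\<lambda>S. \<not> has_cycle (grid_graph m n (two_coloring m n a b c d S))) (cells m n) =
      alt_sum (\<lambda>S. \<forall>i\<in>?I. g i (S \<inter> B i)) (\<Union>i\<in>?I. B i)"
    unfolding cells by (intro alt_sum_cong) simp
  also have "\<dots> = (\<Prod>i\<in>?I. alt_sum (g i) (B i))"
  proof (rule alt_sum_UN_disjoint)
    show "B i \<inter> B j = {}" if "i \<in> ?I" "j \<in> ?I" "i \<noteq> j" for i j
    proof -
      have "block_of m n p = k" if "p \<in> B k" "k \<in> ?I" for p k
        using that(1) place_in_cells(2)[OF that(2)] unfolding B_def by blast
      then show ?thesis using that by (metis disjoint_iff)
    qed
  qed (auto simp: B_def window_def)
  also have "\<dots> \<noteq> 0"
  proof -
    have "alt_sum (g i) (B i) \<noteq> 0" for i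
    proof -
      have "alt_sum (g i) (B i) = alt_sum (\<lambda>T. g i (place i ` T)) (window m n i)"
        unfolding B_def using inj_on_subset[OF inj_place[of i] subset_UNIV]
        by (intro alt_sum_image) (simp_all add: window_def)
      also have "\<dots> = alt_sum (\<lambda>T. \<not> has_circuit T) (window m n i)"
        by (simp add: g_def inj_vimage_image_eq[OF inj_place])
      also have "\<dots> \<noteq> 0"
        unfolding window_def using group_size_cases by (intro alt_sum_has_circuit_nonzero)
      finally show ?thesis .
    qed
    then show ?thesis by (simp add: prod_zero_iff)
  qed
  finally show ?thesis .
qed

lemma obtain_four_distinct:
  assumes "infinite A \<or> card A \<ge> 4"
  obtains a b c d where "{a, b, c, d} \<subseteq> A" "distinct [a, b, c, d]"
proof -
  obtain B where B: "B \<subseteq> A" "card B = 4"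
    using assms infinite_arbitrarily_large obtain_subset_with_card_n by metis
  then obtain xs where "set xs = B" "distinct xs" "length xs = 4"
    by (metis card_eq_0_iff distinct_card finite_distinct_list zero_neq_numeral)
  moreover from this obtain a b c d where "xs = [a, b, c, d]"
    by (auto simp: length_Suc_conv eval_nat_numeral)
  ultimately show ?thesis using that B(1) by auto
qed

theorem theorem1:
  fixes m n :: nat and \<Sigma> :: "'a set" and A :: "'a algorithm"
  assumes "m \<ge> 2" and "n \<ge> 2"
    and "infinite \<Sigma> \<or> card \<Sigma> \<ge> 4"
    and "grid_algorithm m n A"
    and "decides_cycle m n \<Sigma> A"
  shows "\<exists>c \<in> colorings m n \<Sigma>. queried_cells A c = cells m n"
proof -
  obtain a b c d where abcd: "{a, b, c, d} \<subseteq> \<Sigma>" "distinct [a, b, c, d]"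
    using obtain_four_distinct[OF assms(3)] .
  let ?col = "two_coloring m n a b c d"
  have col: "?col S \<in> colorings m n \<Sigma>" for S
    using abcd(1) by (auto simp: colorings_def two_coloring_def)
  have "\<exists>S\<subseteq>cells m n. queried_cells A (?col S) = cells m n"
  proof (rule alt_sum_nonzero_imp_evasive)
    show "finite (cells m n)" by (simp add: cells_def)
    show "\<forall>h p. A h = Query p \<longrightarrow> p \<in> cells m n"
      using assms(4) by (simp add: grid_algorithm_def)
    show "\<forall>S S' p. (p \<in> S \<longleftrightarrow> p \<in> S') \<longrightarrow> ?col S p = ?col S' p"
      by (simp add: two_coloring_def)
    \<comment> \<open>Here \<open>f\<close> is acyclicity, so the required answer is its negation;
      hence the double negation.\<close>
    show "outputs A (?col S) (\<not> \<not> has_cycle (grid_graph m n (?col S)))" for S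
      using assms(5) col by (simp add: decides_cycle_def)
  qed (rule alt_sum_acyclic_nonzero[OF assms(1,2) abcd(2)])
  then show ?thesis using col by blast
qed

end
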